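(* Let $n\ge 1$, let $P=(p_1,\ldots,p_n)$ be positive integers, and let $m\ge 0$ and $k\ge 0$ be integers. Then for every integer $s\ge 1$, $$F(n,k,P,m)=\sum_{i=0}^{s}(-1)^i\binom{s}{i}F(n,k+s,P,m+s-i).$$
   Context: Let $P=(p_1,\ldots,p_n)$ be a finite list of positive integers (repetitions allowed) and $m\ge 0$ an integer. Let $X$ be a finite set which is the disjoint union of "main blocks" $X_1,\ldots,X_n$ with $|X_i|=p_i$ and an "additional block" $X_{n+1}$ with $|X_{n+1}|=m$. For an integer $k\ge 0$, $F(n,k,P,m)$ denotes the number of subsets $U\subseteq X$ with $|U|=n+k$ such that $U\cap X_i\neq\emptyset$ for every $i=1,\ldots,n$. For $k<0$ one sets $F(n,k,P,m)=0$. *)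

theory Defs
  imports Complex_Main "HOL-Library.Disjoint_Sets"
begin

text \<open>
  Blocks are indexed from \<open>0\<close>: \<open>B i\<close> for \<open>i < n\<close> are the main blocks, \<open>B n\<close> is the additional block.
\<close>

definition main_meeting_subsets :: "nat \<Rightarrow> int \<Rightarrow> (nat \<Rightarrow> 'a set) \<Rightarrow> 'a set set" where
  "main_meeting_subsets n k B =
     {U. U \<subseteq> (\<Union>i\<le>n. B i) \<and> int (card U) = int n + k \<and> (\<forall>i<n. U \<inter> B i \<noteq> {})}"

text \<open>
  A concrete disjoint family with the prescribed block sizes. By \<open>F_eq_card\<close> below, the count
  does not depend on this choice.
\<close>

definition std_block :: "nat \<Rightarrow> nat list \<Rightarrow> nat \<Rightarrow> nat \<Rightarrow> (nat \<times> nat) set" where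
  "std_block n P m i = {i} \<times> {..<(if i < n then P ! i else m)}"

definition F :: "nat \<Rightarrow> int \<Rightarrow> nat list \<Rightarrow> nat \<Rightarrow> nat" where
  "F n k P m = (if k < 0 then 0 else card (main_meeting_subsets n k (std_block n P m)))"

lemma F_eq_card:
  fixes B :: "nat \<Rightarrow> 'a set"
  assumes disj: "disjoint_family_on B {..n}"
    and fin: "\<And>i. i \<le> n \<Longrightarrow> finite (B i)"
    and main: "\<And>i. i < n \<Longrightarrow> card (B i) = P ! i"
    and additional: "card (B n) = m"
    and k: "k \<ge> 0"
  shows "F n k P m = card (main_meeting_subsets n k B)"
proof -
  let ?S = "std_block n P m"
  have "\<exists>f. bij_betw f (B i) (?S i)" if "i \<le> n" for i
    by (rule finite_same_card_bij)
       (use that fin main additional in \<open>auto simp: std_block_def card_cartesian_product le_less\<close>)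
  then obtain f where f: "\<And>i. i \<le> n \<Longrightarrow> bij_betw (f i) (B i) (?S i)" by metis
  define X where "X = (\<Union>i\<le>n. B i)"
  define g where "g x = f (THE i. i \<le> n \<and> x \<in> B i) x" for x
  have g: "g x = f i x" if "i \<le> n" "x \<in> B i" for i x
  proof -
    have "(THE i. i \<le> n \<and> x \<in> B i) = i"
      using that disj by (intro the_equality) (auto simp: disjoint_family_on_def)
    then show ?thesis by (simp add: g_def)
  qed
  have gB: "g ` B i = ?S i" if "i \<le> n" for i
    using f[OF that] g[OF that] by (auto simp: bij_betw_def)
  have inj: "inj_on g X"
  proof (rule inj_onI)
    fix x y assume "x \<in> X" "y \<in> X" and eq: "g x = g y"
    then obtain i j where i: "i \<le> n" "x \<in> B i" and j: "j \<le> n" "y \<in> B j"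
      by (auto simp: X_def)
    have "g x \<in> ?S i" "g y \<in> ?S j" using i j gB by blast+
    then have "i = j" using eq by (auto simp: std_block_def)
    then show "x = y"
      using eq i j g f[of i] by (auto simp: bij_betw_def dest: inj_onD)
  qed
  have gX: "g ` X = (\<Union>i\<le>n. ?S i)"
    using gB by (auto simp: X_def image_UN)
  have meet: "g ` U \<inter> ?S i = g ` (U \<inter> B i)" if "U \<subseteq> X" "i < n" for U i
  proof -
    have "B i \<subseteq> X" using that(2) less_imp_le unfolding X_def by blast
    then show ?thesis using inj_on_image_Int[OF inj, of U "B i"] that gB[of i] by simp
  qed
  have cardg: "card (g ` U) = card U" if "U \<subseteq> X" for U
    using inj that by (meson card_image inj_on_subset)
  have "bij_betw ((`) g) (main_meeting_subsets n k B) (main_meeting_subsets n k ?S)"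
  proof (rule bij_betwI')
    fix U V assume "U \<in> main_meeting_subsets n k B" "V \<in> main_meeting_subsets n k B"
    then show "(g ` U = g ` V) = (U = V)"
      using inj by (simp add: main_meeting_subsets_def X_def inj_on_image_eq_iff)
  next
    fix U assume U: "U \<in> main_meeting_subsets n k B"
    then have "U \<subseteq> X" by (simp add: main_meeting_subsets_def X_def)
    moreover from this have "g ` U \<subseteq> (\<Union>i\<le>n. ?S i)" using gX by blast
    ultimately show "g ` U \<in> main_meeting_subsets n k ?S"
      using U meet[of U] cardg[of U] by (simp add: main_meeting_subsets_def)
  next
    fix V assume V: "V \<in> main_meeting_subsets n k ?S"
    then have "V \<subseteq> g ` X" by (simp add: main_meeting_subsets_def gX)
    then obtain U where U: "U \<subseteq> X" "V = g ` U" by (meson subset_imageE)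
    then have "U \<in> main_meeting_subsets n k B"
      using V meet[of U] cardg[of U] by (simp add: main_meeting_subsets_def X_def[symmetric])
    then show "\<exists>U \<in> main_meeting_subsets n k B. V = g ` U" using U by blast
  qed
  then show ?thesis using k by (simp add: F_def bij_betw_same_card)
qed

end

theory Submission
  imports Defs
begin

text \<open>
  Splitting the counted subsets by whether they contain a fixed element of the additional block
  gives the Pascal-type rule \<open>F(n,k+1,P,m+1) = F(n,k+1,P,m) + F(n,k,P,m)\<close>, so that \<open>F(n,k,P,m)\<close>
  is a first difference in \<open>m\<close> of \<open>F(n,k+1,P,\<cdot>)\<close>. The right-hand side of the theorem is the
  \<open>s\<close>-th iterate of this difference.
\<close>

text \<open>The values of \<open>std_block\<close> depend on the additional size at every index from
  \<open>n\<close> on, so enlarging it changes the family beyond \<open>n\<close> too. It then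
  differs there from an update at \<open>n\<close> alone, and equality can be used only up to
  \<open>n\<close>.\<close>

lemma main_meeting_subsets_cong:
  assumes "\<And>i. i \<le> n \<Longrightarrow> B i = C i"
  shows "main_meeting_subsets n k B = main_meeting_subsets n k C"
  using assms by (simp add: main_meeting_subsets_def)

lemma finite_main_meeting_subsets:
  assumes "\<And>i. i \<le> n \<Longrightarrow> finite (B i)"
  shows "finite (main_meeting_subsets n k B)"
proof (rule finite_subset)
  show "main_meeting_subsets n k B \<subseteq> Pow (\<Union>i\<le>n. B i)"
    by (auto simp: main_meeting_subsets_def)
  show "finite (Pow (\<Union>i\<le>n. B i))"
    using assms by simp
qed

text \<open>As \<open>x\<close> lies in no main block, removing it from \<open>U\<close> lowers the
  size by one and leaves all intersections with main blocks unchanged.\<close>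

lemma main_meeting_subsets_insert_additional:
  assumes fin: "\<And>i. i \<le> n \<Longrightarrow> finite (B i)" and x: "x \<notin> (\<Union>i\<le>n. B i)"
  shows "main_meeting_subsets n (k + 1) (B(n := insert x (B n))) =
    main_meeting_subsets n (k + 1) B \<union> insert x ` main_meeting_subsets n k B"
    (is "?L = ?R1 \<union> ?R2")
proof -
  have union: "(\<Union>i\<le>n. (B(n := insert x (B n))) i) = insert x (\<Union>i\<le>n. B i)"
    by (auto split: if_splits)
  have finX: "finite (\<Union>i\<le>n. B i)"
    using fin by simp
  \<comment> \<open>The update at \<open>n\<close> leaves the blocks with \<open>i < n\<close>
    alone, so the meeting condition can be stated with \<open>B\<close> itself.\<close>
  have L: "U \<in> ?L \<longleftrightarrow> U \<subseteq> insert x (\<Union>i\<le>n. B i) \<and> int (card U) = int n + k + 1 \<and>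
      (\<forall>i<n. U \<inter> B i \<noteq> {})" for U
    unfolding main_meeting_subsets_def union by auto
  have card: "card (insert x V) = Suc (card V)" if "V \<subseteq> (\<Union>i\<le>n. B i)" for V
    using finite_subset[OF that finX] that x by (intro card_insert_disjoint) auto
  have meet: "insert x V \<inter> B i = V \<inter> B i" if "i < n" for V i
    using x that by auto
  show ?thesis
  proof (intro equalityI subsetI)
    fix U assume U: "U \<in> ?L"
    show "U \<in> ?R1 \<union> ?R2"
    proof (cases "x \<in> U")
      case True
      define V where "V = U - {x}"
      have UV: "U = insert x V" and V: "V \<subseteq> (\<Union>i\<le>n. B i)"
        using True U unfolding V_def L by auto
      have "V \<in> main_meeting_subsets n k B"
        using U V card[OF V] meet[of _ V] unfolding L UV main_meeting_subsets_def by simp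
      then show ?thesis using UV by blast
    next
      case False
      then have "U \<in> ?R1"
        using U unfolding L main_meeting_subsets_def by (auto simp: subset_insert)
      then show ?thesis ..
    qed
  next
    fix U assume "U \<in> ?R1 \<union> ?R2"
    then show "U \<in> ?L"
    proof
      assume "U \<in> ?R1"
      then show ?thesis
        unfolding L main_meeting_subsets_def by auto
    next
      assume "U \<in> ?R2"
      then obtain V where V: "V \<in> main_meeting_subsets n k B" and UV: "U = insert x V"
        by blast
      from V have "V \<subseteq> (\<Union>i\<le>n. B i)"
        by (simp add: main_meeting_subsets_def)
      with V card[of V] meet[of _ V] show ?thesis
        unfolding L UV by (auto simp: main_meeting_subsets_def)
    qed
  qed
qed

text \<open>No set counted for \<open>B\<close> contains \<open>x\<close>. Hence
  \<open>insert x\<close> is injective on these sets, and its images differ from all of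
  them.\<close>

lemma card_main_meeting_subsets_insert_additional:
  assumes fin: "\<And>i. i \<le> n \<Longrightarrow> finite (B i)" and x: "x \<notin> (\<Union>i\<le>n. B i)"
  shows "card (main_meeting_subsets n (k + 1) (B(n := insert x (B n)))) =
    card (main_meeting_subsets n (k + 1) B) + card (main_meeting_subsets n k B)"
proof -
  have notin: "x \<notin> U" if "U \<in> main_meeting_subsets n l B" for U l
    using that x by (auto simp: main_meeting_subsets_def)
  have "inj_on (insert x) (main_meeting_subsets n k B)"
    using notin by (intro inj_onI) (metis insert_ident)
  moreover have "main_meeting_subsets n (k + 1) B \<inter> insert x ` main_meeting_subsets n k B = {}"
    using notin by blast
  ultimately show ?thesis
    using finite_main_meeting_subsets[of n B, OF fin]
    by (simp add: main_meeting_subsets_insert_additional[OF fin x] card_Un_disjoint card_image)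
qed

lemma F_Suc_additional:
  assumes "k \<ge> 0"
  shows "F n (k + 1) P (Suc m) = F n (k + 1) P m + F n k P m"
proof -
  let ?B = "std_block n P m"
  \<comment> \<open>The additional block grows from \<open>{n} \<times> {..<m}\<close> by exactly
    the pair \<open>(n, m)\<close>.\<close>
  have "main_meeting_subsets n (k + 1) (std_block n P (Suc m)) =
      main_meeting_subsets n (k + 1) (?B(n := insert (n, m) (?B n)))"
    by (rule main_meeting_subsets_cong) (auto simp: std_block_def)
  moreover have "(n, m) \<notin> (\<Union>i\<le>n. ?B i)"
    by (auto simp: std_block_def)
  moreover have "finite (?B i)" for i
    by (simp add: std_block_def)
  ultimately show ?thesis
    using assms by (simp add: F_def card_main_meeting_subsets_insert_additional)
qed

text \<open>Pascal's rule splits each term with positive index in two. The parts with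
  \<open>s choose i\<close> carry the opposite sign and give the subtracted
  \<open>g (Suc i)\<close>; the others, together with \<open>g 0\<close>, form the sum of the
  \<open>g i\<close>.\<close>

lemma alternating_binomial_sum_Suc:
  fixes g :: "nat \<Rightarrow> 'a::comm_ring_1"
  shows "(\<Sum>i\<le>Suc s. (-1) ^ i * of_nat (Suc s choose i) * g i) =
    (\<Sum>i\<le>s. (-1) ^ i * of_nat (s choose i) * (g i - g (Suc i)))"
proof -
  have "(\<Sum>i\<le>Suc s. (-1) ^ i * of_nat (Suc s choose i) * g i) =
      g 0 + (\<Sum>i\<le>s. (-1) ^ Suc i * of_nat (s choose Suc i) * g (Suc i))
        - (\<Sum>i\<le>s. (-1) ^ i * of_nat (s choose i) * g (Suc i))"
    by (simp only: sum.atMost_Suc_shift) (simp add: algebra_simps sum.distrib sum_negf sum_subtractf)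
  also have "g 0 + (\<Sum>i\<le>s. (-1) ^ Suc i * of_nat (s choose Suc i) * g (Suc i)) =
      (\<Sum>i\<le>Suc s. (-1) ^ i * of_nat (s choose i) * g i)"
    by (simp only: sum.atMost_Suc_shift) simp
  \<comment> \<open>The top term vanishes because \<open>s choose Suc s\<close> is zero.\<close>
  also have "\<dots> = (\<Sum>i\<le>s. (-1) ^ i * of_nat (s choose i) * g i)"
    by (simp add: binomial_eq_0)
  finally show ?thesis
    by (simp add: right_diff_distrib sum_subtractf)
qed

text \<open>Induction on \<open>s\<close>: passing from \<open>s\<close> to \<open>Suc s\<close>
  replaces each value of \<open>F\<close> by a difference in the additional size. Both
  \<open>k\<close> and \<open>m\<close> stay fixed throughout.\<close>

lemma F_eq_iterated_difference:
  assumes "k \<ge> 0"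
  shows "int (F n k P m) =
    (\<Sum>i\<le>s. (-1) ^ i * int (s choose i) * int (F n (k + int s) P (m + s - i)))"
proof (induction s)
  case 0
  show ?case by simp
next
  case (Suc s)
  let ?g = "\<lambda>i. int (F n (k + int (Suc s)) P (m + Suc s - i))"
  \<comment> \<open>The bound \<open>i \<le> s\<close> keeps the natural subtraction from
    truncating: \<open>m + Suc s - i\<close> is then the successor of
    \<open>m + s - i\<close>.\<close>
  have diff: "?g i - ?g (Suc i) = int (F n (k + int s) P (m + s - i))" if "i \<le> s" for i
    using F_Suc_additional[of "k + int s" n P "m + s - i"] assms that
    by (simp add: Suc_diff_le add.commute add.left_commute)
  have "(\<Sum>i\<le>Suc s. (-1) ^ i * int (Suc s choose i) * ?g i) =
      (\<Sum>i\<le>s. (-1) ^ i * int (s choose i) * (?g i - ?g (Suc i)))"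
    by (rule alternating_binomial_sum_Suc)
  also have "\<dots> = int (F n k P m)"
    unfolding Suc.IH by (intro sum.cong refl arg_cong2[where f = "(*)"] diff) simp
  finally show ?case ..
qed

theorem theorem3:
  fixes n m s :: nat and k :: int and P :: "nat list"
  assumes "n \<ge> 1"
    and "length P = n"
    and "\<forall>p \<in> set P. p > 0"
    and "k \<ge> 0"
    and "s \<ge> 1"
  shows "int (F n k P m) =
    (\<Sum>i=0..s. (-1) ^ i * int (s choose i) * int (F n (k + int s) P (m + s - i)))"
  using F_eq_iterated_difference[OF \<open>k \<ge> 0\<close>] by (simp only: atLeast0AtMost)

end
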